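(* For every $\mathbb{Z}$-linear map $\lambda \colon \mathbb{Z}^2 \to \mathbb{Z}$, there exists $k \in \mathbb{Z}$ such that $\mathrm{EH}_\lambda \cong \mathrm{EH}_k$ as $\Bbbk$-algebras.
   Context: $\Bbbk$ is an integral domain and $q \in \Bbbk^\times$ is such that $\{d\} := q^d - q^{-d} \in \Bbbk^\times$ for all integers $d \ne 0$. Let $\mathbf{Z} := \mathbb{Z}^2$, $\mathbf{Z}^* := \mathbf{Z}\setminus\{(0,0)\}$, $\mathbf{Z}_\Bbbk := \Bbbk\otimes_{\mathbb{Z}}\mathbf{Z}$. $\widetilde{\mathfrak{EH}}$ is the Lie algebra over $\Bbbk$ which is, as a $\Bbbk$-module, the direct sum of the free module with basis $w_{\mathbf x}$, $\mathbf x\in\mathbf{Z}^*$, and $\mathbf{Z}_\Bbbk$, with $\mathbf{Z}_\Bbbk$ central and $[w_{\mathbf x}, w_{\mathbf y}] = \{d\}\,w_{\mathbf x+\mathbf y} + \delta_{\mathbf x,-\mathbf y}\,\mathbf x$, $d = \det(\mathbf x\ \mathbf y)$ (determinant of the matrix with columns $\mathbf x,\mathbf y$), with $w_{(0,0)} := 0$. Let $\widetilde{\mathrm{EH}}$ be its universal enveloping algebra. For a $\mathbb{Z}$-linear map $\lambda \colon \mathbf{Z}\to\mathbb{Z}$, $\mathrm{EH}_\lambda := \widetilde{\mathrm{EH}}/\langle \mathbf x - \lambda(\mathbf x) : \mathbf x\in\mathbf{Z}\rangle$ (quotient by a two-sided ideal, $\mathbf x$ viewed in $\mathbf{Z}_\Bbbk$).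 For $k\in\mathbb{Z}$, $\mathrm{EH}_k := \mathrm{EH}_{\lambda_k}$, where $\lambda_k(r,n) = kn$. *)

theory Defs
  imports "HOL-Algebra.QuotRing" "HOL-Algebra.Module" "HOL-Library.Product_Plus"
begin

section \<open>Algebras over a commutative ring\<close>

text \<open>
  The record type of modules has multiplication and unit fields, so it also carries associative
  unital, not necessarily commutative, algebras.  In the quotient by a two-sided ideal, the union in
  the scalar multiplication is over representatives of a coset, all of which give the same coset.
\<close>

definition alg_quot :: "('a, 'b) module \<Rightarrow> 'b set \<Rightarrow> ('a, 'b set) module" where
  "alg_quot A I =
    \<lparr>carrier = carrier (A Quot I), mult = mult (A Quot I), one = one (A Quot I),
     zero = zero (A Quot I), add = add (A Quot I),
     smult = (\<lambda>c C. \<Union>a\<in>C. I +>\<^bsub>A\<^esub> (c \<odot>\<^bsub>A\<^esub> a))\<rparr>"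

definition alg_iso ::
    "('a, 'm) ring_scheme \<Rightarrow> ('a, 'b) module \<Rightarrow> ('a, 'c) module \<Rightarrow> ('b \<Rightarrow> 'c) set" where
  "alg_iso R A B =
    {h \<in> ring_iso A B. \<forall>c\<in>carrier R. \<forall>a\<in>carrier A. h (c \<odot>\<^bsub>A\<^esub> a) = c \<odot>\<^bsub>B\<^esub> h a}"

definition is_alg_iso ::
    "('a, 'm) ring_scheme \<Rightarrow> ('a, 'b) module \<Rightarrow> ('a, 'c) module \<Rightarrow> bool" where
  "is_alg_iso R A B \<longleftrightarrow> alg_iso R A B \<noteq> {}"

text \<open>
  The free unital associative algebra on a set: finitely supported functions on words, with
  concatenation of words extended bilinearly.
\<close>

definition free_alg :: "('a, 'm) ring_scheme \<Rightarrow> 'x set \<Rightarrow> ('a, 'x list \<Rightarrow> 'a) module" where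
  "free_alg R S =
    \<lparr>carrier = {f. (\<forall>u. f u \<in> carrier R) \<and> finite {u. f u \<noteq> \<zero>\<^bsub>R\<^esub>} \<and>
                   (\<forall>u. u \<notin> lists S \<longrightarrow> f u = \<zero>\<^bsub>R\<^esub>)},
     mult = (\<lambda>f g u. \<Oplus>\<^bsub>R\<^esub>i\<in>{..length u}. f (take i u) \<otimes>\<^bsub>R\<^esub> g (drop i u)),
     one = (\<lambda>u. if u = [] then \<one>\<^bsub>R\<^esub> else \<zero>\<^bsub>R\<^esub>),
     zero = (\<lambda>u. \<zero>\<^bsub>R\<^esub>),
     add = (\<lambda>f g u. f u \<oplus>\<^bsub>R\<^esub> g u),
     smult = (\<lambda>c f u. c \<otimes>\<^bsub>R\<^esub> f u)\<rparr>"

definition free_gen :: "('a, 'm) ring_scheme \<Rightarrow> 'x \<Rightarrow> 'x list \<Rightarrow> 'a" where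
  "free_gen R x = (\<lambda>u. if u = [x] then \<one>\<^bsub>R\<^esub> else \<zero>\<^bsub>R\<^esub>)"

section \<open>Universal enveloping algebras\<close>

text \<open>The multiplication and unit fields inherited from module records play no role here.\<close>

record ('a, 'b) lie_alg = "('a, 'b) module" +
  lie_bracket :: "'b \<Rightarrow> 'b \<Rightarrow> 'b"

text \<open>
  The tensor algebra of \<open>L\<close> is the free algebra on the set \<open>L\<close> modulo the linear relations,
  and the enveloping algebra is the tensor algebra modulo the commutator relations.  Both kinds of
  relations are imposed at once.
\<close>

definition ue_relations ::
    "('a, 'm) ring_scheme \<Rightarrow> ('a, 'b) lie_alg \<Rightarrow> ('b list \<Rightarrow> 'a) set" where
  "ue_relations R L =
    (let F = free_alg R (carrier L); g = free_gen R in
      {g (x \<oplus>\<^bsub>L\<^esub> y) \<ominus>\<^bsub>F\<^esub> (g x \<oplus>\<^bsub>F\<^esub> g y) | x y. x \<in> carrier L \<and> y \<in> carrier L}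
      \<union> {g (c \<odot>\<^bsub>L\<^esub> x) \<ominus>\<^bsub>F\<^esub> (c \<odot>\<^bsub>F\<^esub> g x) | c x. c \<in> carrier R \<and> x \<in> carrier L}
      \<union> {(g x \<otimes>\<^bsub>F\<^esub> g y \<ominus>\<^bsub>F\<^esub> g y \<otimes>\<^bsub>F\<^esub> g x) \<ominus>\<^bsub>F\<^esub> g (lie_bracket L x y)
          | x y. x \<in> carrier L \<and> y \<in> carrier L})"

definition ue_ideal ::
    "('a, 'm) ring_scheme \<Rightarrow> ('a, 'b) lie_alg \<Rightarrow> ('b list \<Rightarrow> 'a) set" where
  "ue_ideal R L = Idl\<^bsub>free_alg R (carrier L)\<^esub> (ue_relations R L)"

definition univ_env ::
    "('a, 'm) ring_scheme \<Rightarrow> ('a, 'b) lie_alg \<Rightarrow> ('a, ('b list \<Rightarrow> 'a) set) module" where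
  "univ_env R L = alg_quot (free_alg R (carrier L)) (ue_ideal R L)"

definition ue_incl ::
    "('a, 'm) ring_scheme \<Rightarrow> ('a, 'b) lie_alg \<Rightarrow> 'b \<Rightarrow> ('b list \<Rightarrow> 'a) set" where
  "ue_incl R L x = ue_ideal R L +>\<^bsub>free_alg R (carrier L)\<^esub> free_gen R x"

section \<open>The elliptic Hall Lie algebra and its quotients\<close>

text \<open>For \<open>q\<close> a unit; the integer power of the library uses the inverse of \<open>q\<close> in \<open>R\<close>.\<close>

definition qdiff :: "('a, 'm) ring_scheme \<Rightarrow> 'a \<Rightarrow> int \<Rightarrow> 'a" where
  "qdiff R q d = q [^]\<^bsub>R\<^esub> d \<ominus>\<^bsub>R\<^esub> q [^]\<^bsub>R\<^esub> (- d)"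

definition det2 :: "int \<times> int \<Rightarrow> int \<times> int \<Rightarrow> int" where
  "det2 x y = fst x * snd y - fst y * snd x"

text \<open>
  The first component of an element holds its coordinates with respect to the \<open>w x\<close> for
  \<open>x \<noteq> 0\<close>; its value at \<open>0\<close> is forced to vanish.  The second component is the element of
  the scalar extension of \<open>\<int>\<^sup>2\<close>, in coordinates with respect to the standard basis.
\<close>

type_synonym 'a eh_elem = "(int \<times> int \<Rightarrow> 'a) \<times> ('a \<times> 'a)"

definition eh_module :: "('a, 'm) ring_scheme \<Rightarrow> ('a, 'a eh_elem) module" where
  "eh_module R =
    \<lparr>carrier = {f. (\<forall>x. f x \<in> carrier R) \<and> finite {x. f x \<noteq> \<zero>\<^bsub>R\<^esub>} \<and> f 0 = \<zero>\<^bsub>R\<^esub>}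
               \<times> (carrier R \<times> carrier R),
     mult = undefined, one = undefined,
     zero = (\<lambda>x. \<zero>\<^bsub>R\<^esub>, (\<zero>\<^bsub>R\<^esub>, \<zero>\<^bsub>R\<^esub>)),
     add = (\<lambda>(f, (a, b)) (g, (c, d)). (\<lambda>x. f x \<oplus>\<^bsub>R\<^esub> g x, (a \<oplus>\<^bsub>R\<^esub> c, b \<oplus>\<^bsub>R\<^esub> d))),
     smult = (\<lambda>r (f, (a, b)). (\<lambda>x. r \<otimes>\<^bsub>R\<^esub> f x, (r \<otimes>\<^bsub>R\<^esub> a, r \<otimes>\<^bsub>R\<^esub> b)))\<rparr>"

definition eh_w :: "('a, 'm) ring_scheme \<Rightarrow> int \<times> int \<Rightarrow> 'a eh_elem" where
  "eh_w R x = (\<lambda>z. if z = x \<and> x \<noteq> 0 then \<one>\<^bsub>R\<^esub> else \<zero>\<^bsub>R\<^esub>, (\<zero>\<^bsub>R\<^esub>, \<zero>\<^bsub>R\<^esub>))"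

definition eh_central :: "('a, 'm) ring_scheme \<Rightarrow> int \<times> int \<Rightarrow> 'a eh_elem" where
  "eh_central R x =
    (\<lambda>z. \<zero>\<^bsub>R\<^esub>, ([fst x] \<cdot>\<^bsub>R\<^esub> \<one>\<^bsub>R\<^esub>, [snd x] \<cdot>\<^bsub>R\<^esub> \<one>\<^bsub>R\<^esub>))"

definition eh_w_bracket ::
    "('a, 'm) ring_scheme \<Rightarrow> 'a \<Rightarrow> int \<times> int \<Rightarrow> int \<times> int \<Rightarrow> 'a eh_elem" where
  "eh_w_bracket R q x y =
    (qdiff R q (det2 x y) \<odot>\<^bsub>eh_module R\<^esub> eh_w R (x + y))
      \<oplus>\<^bsub>eh_module R\<^esub> (if x = - y then eh_central R x else \<zero>\<^bsub>eh_module R\<^esub>)"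

text \<open>The bilinear extension of the bracket of the \<open>w x\<close>; second components are central.\<close>

definition eh_bracket ::
    "('a, 'm) ring_scheme \<Rightarrow> 'a \<Rightarrow> 'a eh_elem \<Rightarrow> 'a eh_elem \<Rightarrow> 'a eh_elem" where
  "eh_bracket R q a b =
    (\<Oplus>\<^bsub>eh_module R\<^esub>x\<in>{x. fst a x \<noteq> \<zero>\<^bsub>R\<^esub>}. \<Oplus>\<^bsub>eh_module R\<^esub>y\<in>{y. fst b y \<noteq> \<zero>\<^bsub>R\<^esub>}.
      (fst a x \<otimes>\<^bsub>R\<^esub> fst b y) \<odot>\<^bsub>eh_module R\<^esub> eh_w_bracket R q x y)"

definition eh_lie :: "('a, 'm) ring_scheme \<Rightarrow> 'a \<Rightarrow> ('a, 'a eh_elem) lie_alg" where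
  "eh_lie R q = module.extend (eh_module R) (lie_alg.fields (eh_bracket R q))"

definition EH_tilde ::
    "('a, 'm) ring_scheme \<Rightarrow> 'a \<Rightarrow> ('a, ('a eh_elem list \<Rightarrow> 'a) set) module" where
  "EH_tilde R q = univ_env R (eh_lie R q)"

definition EH_ideal ::
    "('a, 'm) ring_scheme \<Rightarrow> 'a \<Rightarrow> (int \<times> int \<Rightarrow> int) \<Rightarrow> ('a eh_elem list \<Rightarrow> 'a) set set" where
  "EH_ideal R q lam =
    Idl\<^bsub>EH_tilde R q\<^esub>
      (range (\<lambda>x. ue_incl R (eh_lie R q) (eh_central R x)
                    \<ominus>\<^bsub>EH_tilde R q\<^esub> [lam x] \<cdot>\<^bsub>EH_tilde R q\<^esub> \<one>\<^bsub>EH_tilde R q\<^esub>))"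

definition EH ::
    "('a, 'm) ring_scheme \<Rightarrow> 'a \<Rightarrow> (int \<times> int \<Rightarrow> int) \<Rightarrow>
      ('a, ('a eh_elem list \<Rightarrow> 'a) set set) module" where
  "EH R q lam = alg_quot (EH_tilde R q) (EH_ideal R q lam)"

definition lam_k :: "int \<Rightarrow> int \<times> int \<Rightarrow> int" where
  "lam_k k = (\<lambda>(r, n). k * n)"

definition EH_k ::
    "('a, 'm) ring_scheme \<Rightarrow> 'a \<Rightarrow> int \<Rightarrow> ('a, ('a eh_elem list \<Rightarrow> 'a) set set) module" where
  "EH_k R q k = EH R q (lam_k k)"

definition int_linear :: "(int \<times> int \<Rightarrow> int) \<Rightarrow> bool" where
  "int_linear lam \<longleftrightarrow>
    (\<forall>x y. lam (x + y) = lam x + lam y) \<and> (\<forall>m r n. lam (m * r, m * n) = m * lam (r, n))"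

end

theory Submission
  imports Defs
begin

text \<open>
  The group \<open>SL\<^sub>2(\<int>)\<close> acts on the Lie algebra by automorphisms: \<open>g\<close> sends
  \<open>w x\<close> to \<open>w (g x)\<close> and acts on the central part by extending scalars.  This respects the
  bracket because the structure constants depend only on \<open>det (x y)\<close>, which \<open>g\<close> preserves,
  and because the central term at \<open>y = - x\<close> is \<open>x\<close> itself.  The induced automorphism of the
  enveloping algebra carries the relation \<open>x = \<lambda>(x)\<close> to \<open>g x = \<lambda>(x)\<close>, which is the
  relation of \<open>\<lambda> \<circ> g\<^sup>-\<^sup>1\<close> at \<open>g x\<close>; hence the quotients for \<open>\<lambda>\<close> and for
  \<open>\<lambda> \<circ> g\<^sup>-\<^sup>1\<close> are isomorphic (\<open>EH_alg_iso\<close>).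

  It remains to find \<open>g\<close> with \<open>\<lambda> = \<lambda>\<^sub>k \<circ> g\<close> (\<open>int_linear_normal_form\<close>).  Write
  \<open>\<lambda>(r, n) = c r + d n\<close> and \<open>k = gcd c d\<close>.  If \<open>k \<noteq> 0\<close>, then the row \<open>(c/k, d/k)\<close>
  is primitive, and a Bezout identity completes it to a matrix of determinant \<open>1\<close> with this bottom
  row.  If \<open>k = 0\<close>, then \<open>\<lambda> = 0\<close> and \<open>g = 1\<close> will do.

  The passage from the Lie algebra to the quotient algebra rests on three functoriality facts: a
  bijection of generators induces an isomorphism of free algebras (\<open>free_map_alg_iso\<close>), an
  isomorphism of algebras descends to the quotients by the ideals generated by a set and by its image
  (\<open>alg_iso_quotient\<close>), and an isomorphism of Lie algebras matches the defining relations of the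
  enveloping algebras (\<open>ue_relations_image\<close>).
\<close>

section \<open>Quotients of associative algebras\<close>

text \<open>
  What quotients by two-sided ideals need of an algebra: scalars act through left multiplication by
  \<open>c \<odot> 1\<close>, so that every ideal is closed under scalars.
\<close>

locale scalar_alg = ring A for R :: "('a, 'm) ring_scheme" and A :: "('a, 'b) module" (structure) +
  assumes scalar_closed: "c \<in> carrier R \<Longrightarrow> c \<odot> \<one> \<in> carrier A"
    and smult_eq: "\<lbrakk>c \<in> carrier R; a \<in> carrier A\<rbrakk> \<Longrightarrow> c \<odot> a = (c \<odot> \<one>) \<otimes> a"
begin

lemma smult_closed: "\<lbrakk>c \<in> carrier R; a \<in> carrier A\<rbrakk> \<Longrightarrow> c \<odot> a \<in> carrier A"
  by (subst smult_eq) (auto intro: scalar_closed)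

end

lemma alg_quot_simps [simp]:
  "carrier (alg_quot A I) = carrier (A Quot I)"
  "mult (alg_quot A I) = mult (A Quot I)"
  "one (alg_quot A I) = one (A Quot I)"
  "zero (alg_quot A I) = zero (A Quot I)"
  "add (alg_quot A I) = add (A Quot I)"
  by (simp_all add: alg_quot_def)

lemma ring_alg_quot:
  assumes I: "ideal I A"
  shows "ring (alg_quot A I)"
proof -
  interpret I: ideal I A by fact
  have "id \<in> ring_iso (A Quot I) (alg_quot A I)"
    by (rule ring_iso_memI) auto
  from ring.ring_iso_imp_img_ring[OF I.quotient_is_ring this]
  show ?thesis
    by (simp add: alg_quot_def)
qed

text \<open>
  All representatives \<open>b\<close> of the coset of \<open>a\<close> give the same coset of \<open>c \<odot> b\<close>, since
  \<open>c \<odot> (i + a) = (c \<odot> 1) i + c \<odot> a\<close> and the ideal absorbs \<open>(c \<odot> 1) i\<close>.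
\<close>

lemma (in scalar_alg) smult_coset:
  assumes I: "ideal I A" and c: "c \<in> carrier R" and a: "a \<in> carrier A"
  shows "c \<odot>\<^bsub>alg_quot A I\<^esub> (I +> a) = I +> c \<odot> a"
proof -
  interpret I: ideal I A by fact
  have *: "I +> c \<odot> b = I +> c \<odot> a" if b: "b \<in> I +> a" for b
  proof -
    obtain i where i: "i \<in> I" "b = i \<oplus> a"
      using b by (auto simp: a_r_coset_def')
    have cl: "i \<in> carrier A" "c \<odot> \<one> \<in> carrier A"
      by (rule I.Icarr[OF i(1)], rule scalar_closed[OF c])
    have "c \<odot> b = (c \<odot> \<one>) \<otimes> (i \<oplus> a)"
      unfolding i(2) by (rule smult_eq[OF c]) (use cl a in simp)
    also have "\<dots> = (c \<odot> \<one>) \<otimes> i \<oplus> (c \<odot> \<one>) \<otimes> a"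
      by (rule r_distr[OF cl(1) a cl(2)])
    also have "(c \<odot> \<one>) \<otimes> a = c \<odot> a"
      by (rule smult_eq[OF c a, symmetric])
    finally have "c \<odot> b = (c \<odot> \<one>) \<otimes> i \<oplus> c \<odot> a" .
    then have mem: "c \<odot> b \<in> I +> c \<odot> a"
      using I.I_l_closed[OF i(1) cl(2)] unfolding a_r_coset_def' by blast
    show ?thesis
      by (rule a_repr_independence[OF mem smult_closed[OF c a] I.a_subgroup, symmetric])
  qed
  have "(\<Union>b\<in>I +> a. I +> c \<odot> b) = I +> c \<odot> a"
    by (rule SUP_eq_const) (use I.a_rcos_self[OF a] in blast, rule *)
  then show ?thesis
    by (simp add: alg_quot_def)
qed

lemma carrier_Quot: "carrier (A Quot I) = (\<lambda>a. I +>\<^bsub>A\<^esub> a) ` carrier A"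
  by (auto simp: FactRing_simps)

lemma (in scalar_alg) scalar_alg_alg_quot:
  assumes I: "ideal I A"
  shows "scalar_alg R (alg_quot A I)"
proof -
  interpret I: ideal I A by fact
  interpret Q: ring "alg_quot A I" by (rule ring_alg_quot[OF I])
  have one: "\<one>\<^bsub>alg_quot A I\<^esub> = I +> \<one>" by (simp add: FactRing_def)
  show ?thesis
  proof unfold_locales
    fix c assume c: "c \<in> carrier R"
    show "c \<odot>\<^bsub>alg_quot A I\<^esub> \<one>\<^bsub>alg_quot A I\<^esub> \<in> carrier (alg_quot A I)"
      using c by (simp only: one smult_coset[OF I] one_closed)
        (simp add: carrier_Quot scalar_closed)
    fix C assume "C \<in> carrier (alg_quot A I)"
    then obtain a where a: "a \<in> carrier A" "C = I +> a"
      by (auto simp: carrier_Quot)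
    show "c \<odot>\<^bsub>alg_quot A I\<^esub> C = c \<odot>\<^bsub>alg_quot A I\<^esub> \<one>\<^bsub>alg_quot A I\<^esub> \<otimes>\<^bsub>alg_quot A I\<^esub> C"
      using a c
      by (simp only: one smult_coset[OF I] one_closed smult_eq[OF c a(1)])
        (simp add: FactRing_def I.rcoset_mult_add scalar_closed)
  qed
qed

text \<open>
  The image of an ideal under an isomorphism is an ideal, where surjectivity supplies absorption; it
  contains the image of the generators, and the generated ideal is the least such.
\<close>

lemma genideal_image_le:
  assumes A: "ring A" and B: "ring B" and h: "h \<in> ring_iso A B" and S: "S \<subseteq> carrier A"
  shows "Idl\<^bsub>B\<^esub> (h ` S) \<subseteq> h ` (Idl\<^bsub>A\<^esub> S)"
proof -
  interpret A: ring A by fact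
  interpret B: ring B by fact
  have hom: "h \<in> ring_hom A B" and bij: "bij_betw h (carrier A) (carrier B)"
    using h by (auto simp: ring_iso_def)
  interpret h: ring_hom_ring A B h by (rule ring_hom_ringI2) fact+
  let ?I = "Idl\<^bsub>A\<^esub> S"
  interpret I: ideal ?I A by (rule A.genideal_ideal[OF S])
  have surj: "\<exists>a\<in>carrier A. b = h a" if "b \<in> carrier B" for b
    using bij that by (auto simp: bij_betw_def)
  have "ideal (h ` ?I) B"
  proof (rule idealI)
    show "subgroup (h ` ?I) (add_monoid B)"
      by (rule group_hom.subgroup_img_is_subgroup[OF h.a_group_hom I.a_subgroup])
    fix a x assume "a \<in> h ` ?I" "x \<in> carrier B"
    then obtain i y where iy: "i \<in> ?I" "a = h i" "y \<in> carrier A" "x = h y"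
      using surj by blast
    show "x \<otimes>\<^bsub>B\<^esub> a \<in> h ` ?I"
      using iy I.I_l_closed[of i y] h.hom_mult[of y i, symmetric] I.Icarr by force
    show "a \<otimes>\<^bsub>B\<^esub> x \<in> h ` ?I"
      using iy I.I_r_closed[of i y] h.hom_mult[of i y, symmetric] I.Icarr by force
  qed (rule B)
  then show ?thesis
    using A.genideal_self[OF S] by (intro B.genideal_minimal) auto
qed

text \<open>
  For the other inclusion, the preimage of an ideal is an ideal.
\<close>

lemma genideal_image:
  assumes A: "ring A" and B: "ring B" and h: "h \<in> ring_iso A B" and S: "S \<subseteq> carrier A"
  shows "h ` (Idl\<^bsub>A\<^esub> S) = Idl\<^bsub>B\<^esub> (h ` S)"
proof
  show "Idl\<^bsub>B\<^esub> (h ` S) \<subseteq> h ` (Idl\<^bsub>A\<^esub> S)"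
    by (rule genideal_image_le) fact+
  interpret A: ring A by fact
  interpret B: ring B by fact
  have hom: "h \<in> ring_hom A B" and bij: "bij_betw h (carrier A) (carrier B)"
    using h by (auto simp: ring_iso_def)
  interpret h: ring_hom_ring A B h by (rule ring_hom_ringI2) fact+
  have hS: "h ` S \<subseteq> carrier B" using S by auto
  have "Idl\<^bsub>A\<^esub> S \<subseteq> {r \<in> carrier A. h r \<in> Idl\<^bsub>B\<^esub> (h ` S)}"
    using S B.genideal_self[OF hS]
    by (intro A.genideal_minimal h.ideal_vimage B.genideal_ideal hS) auto
  then show "h ` (Idl\<^bsub>A\<^esub> S) \<subseteq> Idl\<^bsub>B\<^esub> (h ` S)" by auto
qed

lemma coset_image:
  assumes h: "h \<in> ring_hom A B" and "I \<subseteq> carrier A" "a \<in> carrier A"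
  shows "h ` (I +>\<^bsub>A\<^esub> a) = h ` I +>\<^bsub>B\<^esub> h a"
proof -
  have "h (x \<oplus>\<^bsub>A\<^esub> a) = h x \<oplus>\<^bsub>B\<^esub> h a" if "x \<in> I" for x
    using that assms by (intro ring_hom_add[OF h]) auto
  then show ?thesis
    by (simp add: a_r_coset_def' image_UN)
qed

text \<open>
  Cosets are sets of representatives, so the induced map is simply the image map
  \<open>C \<mapsto> h ` C\<close>, which takes the coset of \<open>a\<close> to the coset of \<open>h a\<close>.
\<close>

lemma alg_iso_quotient:
  assumes A: "scalar_alg R A" and B: "scalar_alg R B"
    and h: "h \<in> alg_iso R A B" and S: "S \<subseteq> carrier A"
  shows "(\<lambda>C. h ` C) \<in> alg_iso R (alg_quot A (Idl\<^bsub>A\<^esub> S)) (alg_quot B (Idl\<^bsub>B\<^esub> (h ` S)))"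
proof -
  interpret A: scalar_alg R A by fact
  interpret B: scalar_alg R B by fact
  have iso: "h \<in> ring_iso A B" and hom: "h \<in> ring_hom A B"
    and bij: "bij_betw h (carrier A) (carrier B)"
    using h by (auto simp: alg_iso_def ring_iso_def)
  have hs: "h (c \<odot>\<^bsub>A\<^esub> a) = c \<odot>\<^bsub>B\<^esub> h a" if "c \<in> carrier R" "a \<in> carrier A" for a c
    using h that by (auto simp: alg_iso_def)
  let ?I = "Idl\<^bsub>A\<^esub> S"
  let ?J = "Idl\<^bsub>B\<^esub> (h ` S)"
  have J: "h ` ?I = ?J"
    by (rule genideal_image[OF A.ring_axioms B.ring_axioms iso S])
  have idI: "ideal ?I A" by (rule A.genideal_ideal[OF S])
  have cl: "h a \<in> carrier B" if "a \<in> carrier A" for a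
    using ring_hom_closed[OF hom that] .
  have idJ: "ideal ?J B" using S cl by (intro B.genideal_ideal) auto
  interpret I: ideal ?I A by fact
  interpret J: ideal ?J B by fact
  have co: "h ` (?I +>\<^bsub>A\<^esub> a) = ?J +>\<^bsub>B\<^esub> h a" if "a \<in> carrier A" for a
    using coset_image[OF hom I.a_subset that] by (simp add: J)
  have sub: "?I +>\<^bsub>A\<^esub> a \<subseteq> carrier A" if "a \<in> carrier A" for a
    using that I.a_subset by (auto simp: a_r_coset_def')
  have "(\<lambda>C. h ` C) \<in> ring_iso (alg_quot A ?I) (alg_quot B ?J)"
  proof (rule ring_iso_memI)
    have "carrier B = h ` carrier A" using bij by (simp add: bij_betw_def)
    then have "(\<lambda>C. h ` C) ` carrier (A Quot ?I) = carrier (B Quot ?J)"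
      by (simp add: carrier_Quot image_image co cong: image_cong_simp)
    moreover have "inj_on (\<lambda>C. h ` C) (carrier (A Quot ?I))"
    proof (rule inj_onI)
      fix C D assume "C \<in> carrier (A Quot ?I)" "D \<in> carrier (A Quot ?I)" "h ` C = h ` D"
      moreover from this have "C \<subseteq> carrier A" "D \<subseteq> carrier A"
        using sub by (auto simp: carrier_Quot)
      ultimately show "C = D"
        using bij by (metis bij_betw_def inj_on_image_eq_iff)
    qed
    ultimately show "bij_betw (\<lambda>C. h ` C) (carrier (alg_quot A ?I)) (carrier (alg_quot B ?J))"
      by (simp add: bij_betw_def)
    then show "\<And>x. x \<in> carrier (alg_quot A ?I) \<Longrightarrow> h ` x \<in> carrier (alg_quot B ?J)"
      by (auto simp: bij_betw_def)
    show "h ` \<one>\<^bsub>alg_quot A ?I\<^esub> = \<one>\<^bsub>alg_quot B ?J\<^esub>"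
      by (simp add: FactRing_def co ring_hom_one[OF hom])
    fix C D assume "C \<in> carrier (alg_quot A ?I)" "D \<in> carrier (alg_quot A ?I)"
    then obtain a b where ab: "a \<in> carrier A" "C = ?I +>\<^bsub>A\<^esub> a" "b \<in> carrier A" "D = ?I +>\<^bsub>A\<^esub> b"
      by (auto simp: carrier_Quot)
    show "h ` (C \<otimes>\<^bsub>alg_quot A ?I\<^esub> D) = h ` C \<otimes>\<^bsub>alg_quot B ?J\<^esub> h ` D"
      using ab by (simp add: FactRing_def I.rcoset_mult_add J.rcoset_mult_add co cl ring_hom_mult[OF hom])
    show "h ` (C \<oplus>\<^bsub>alg_quot A ?I\<^esub> D) = h ` C \<oplus>\<^bsub>alg_quot B ?J\<^esub> h ` D"
      using ab by (simp add: FactRing_def I.a_rcos_sum J.a_rcos_sum co cl ring_hom_add[OF hom])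
  qed
  moreover have "h ` (c \<odot>\<^bsub>alg_quot A ?I\<^esub> C) = c \<odot>\<^bsub>alg_quot B ?J\<^esub> h ` C"
    if c: "c \<in> carrier R" and C: "C \<in> carrier (alg_quot A ?I)" for c C
  proof -
    obtain a where a: "a \<in> carrier A" "C = ?I +>\<^bsub>A\<^esub> a"
      using C by (auto simp: carrier_Quot)
    show ?thesis
      unfolding a(2) A.smult_coset[OF idI c a(1)] co[OF a(1)]
        co[OF A.smult_closed[OF c a(1)]] B.smult_coset[OF idJ c cl[OF a(1)]]
        hs[OF c a(1)] ..
  qed
  ultimately show ?thesis by (simp add: alg_iso_def)
qed

section \<open>Free algebras\<close>

lemma free_alg_simps:
  "carrier (free_alg R S) = {f. (\<forall>u. f u \<in> carrier R) \<and> finite {u. f u \<noteq> \<zero>\<^bsub>R\<^esub>} \<and>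
                   (\<forall>u. u \<notin> lists S \<longrightarrow> f u = \<zero>\<^bsub>R\<^esub>)}"
  "f \<otimes>\<^bsub>free_alg R S\<^esub> g = (\<lambda>u. \<Oplus>\<^bsub>R\<^esub>i\<in>{..length u}. f (take i u) \<otimes>\<^bsub>R\<^esub> g (drop i u))"
  "\<one>\<^bsub>free_alg R S\<^esub> = (\<lambda>u. if u = [] then \<one>\<^bsub>R\<^esub> else \<zero>\<^bsub>R\<^esub>)"
  "\<zero>\<^bsub>free_alg R S\<^esub> = (\<lambda>u. \<zero>\<^bsub>R\<^esub>)"
  "f \<oplus>\<^bsub>free_alg R S\<^esub> g = (\<lambda>u. f u \<oplus>\<^bsub>R\<^esub> g u)"
  "c \<odot>\<^bsub>free_alg R S\<^esub> f = (\<lambda>u. c \<otimes>\<^bsub>R\<^esub> f u)"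
  by (simp_all add: free_alg_def)

context ring
begin

text \<open>
  The product of the free algebra, apart from the generating set, on arbitrary functions on words:
  the proofs by induction on a word need the shifted functions \<open>\<lambda>v. f (x # v)\<close>.
\<close>

definition conv :: "('x list \<Rightarrow> 'a) \<Rightarrow> ('x list \<Rightarrow> 'a) \<Rightarrow> 'x list \<Rightarrow> 'a" where
  "conv f g u = (\<Oplus>i\<in>{..length u}. f (take i u) \<otimes> g (drop i u))"

lemma conv_closed:
  assumes "\<And>u. f u \<in> carrier R" "\<And>u. g u \<in> carrier R"
  shows "conv f g u \<in> carrier R"
  unfolding conv_def using assms by (intro finsum_closed) auto

lemma conv_Nil:
  assumes "\<And>u. f u \<in> carrier R" "\<And>u. g u \<in> carrier R"
  shows "conv f g [] = f [] \<otimes> g []"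
  unfolding conv_def using assms by simp

text \<open>
  The splittings of \<open>x # u\<close> are the one with empty left part and those of \<open>u\<close> with \<open>x\<close>
  put in front of the left part.  This recursion replaces manipulations of double sums in the proof
  of associativity.
\<close>

lemma conv_Cons:
  assumes "\<And>u. f u \<in> carrier R" "\<And>u. g u \<in> carrier R"
  shows "conv f g (x # u) = f [] \<otimes> g (x # u) \<oplus> conv (\<lambda>v. f (x # v)) g u"
proof -
  have "{..length (x # u)} = insert 0 (Suc ` {..length u})"
    by (simp add: atMost_Suc_eq_insert_0)
  then have "conv f g (x # u) = f [] \<otimes> g (x # u) \<oplus>
      (\<Oplus>i\<in>Suc ` {..length u}. f (take i (x # u)) \<otimes> g (drop i (x # u)))"
    unfolding conv_def using assms by (simp add: Pi_def)
  also have "(\<Oplus>i\<in>Suc ` {..length u}. f (take i (x # u)) \<otimes> g (drop i (x # u)))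
      = conv (\<lambda>v. f (x # v)) g u"
    unfolding conv_def using assms by (subst finsum_reindex) (auto simp: Pi_def)
  finally show ?thesis .
qed

lemma conv_smult_left:
  assumes "\<And>u. f u \<in> carrier R" "\<And>u. g u \<in> carrier R" "c \<in> carrier R"
  shows "conv (\<lambda>v. c \<otimes> f v) g u = c \<otimes> conv f g u"
  unfolding conv_def using assms by (simp add: finsum_rdistr Pi_def m_assoc)

lemma conv_add_left:
  assumes "\<And>u. f u \<in> carrier R" "\<And>u. g u \<in> carrier R" "\<And>u. h u \<in> carrier R"
  shows "conv (\<lambda>v. f v \<oplus> g v) h u = conv f h u \<oplus> conv g h u"
  unfolding conv_def using assms by (simp add: finsum_addf Pi_def l_distr)

lemma conv_add_right:
  assumes "\<And>u. f u \<in> carrier R" "\<And>u. g u \<in> carrier R" "\<And>u. h u \<in> carrier R"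
  shows "conv f (\<lambda>v. g v \<oplus> h v) u = conv f g u \<oplus> conv f h u"
  unfolding conv_def using assms by (simp add: finsum_addf Pi_def r_distr)

lemma conv_zero_left:
  assumes "\<And>u. g u \<in> carrier R"
  shows "conv (\<lambda>v. \<zero>) g u = \<zero>"
  unfolding conv_def using assms by simp

text \<open>
  Induction on the word, for all three functions at once.  By \<open>conv_Cons\<close>, the function
  \<open>\<lambda>v. conv f g (x # v)\<close> is the sum of a multiple of a shift of \<open>g\<close> and of
  the product of a shift of \<open>f\<close> with \<open>g\<close>; the first part is settled by linearity, the
  second by the induction hypothesis.
\<close>

lemma conv_assoc:
  assumes "\<And>u. f u \<in> carrier R" "\<And>u. g u \<in> carrier R" "\<And>u. h u \<in> carrier R"
  shows "conv (conv f g) h u = conv f (conv g h) u"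
  using assms
proof (induction u arbitrary: f g h)
  case Nil
  then show ?case by (simp add: conv_Nil conv_closed m_assoc)
next
  case (Cons x u)
  let ?f = "\<lambda>v. f (x # v)" and ?g = "\<lambda>v. g (x # v)"
  note cl = Cons.prems conv_closed
  have "conv (conv f g) h (x # u) =
      (f [] \<otimes> g []) \<otimes> h (x # u) \<oplus> conv (\<lambda>v. f [] \<otimes> ?g v \<oplus> conv ?f g v) h u"
    by (simp add: cl conv_Nil conv_Cons)
  also have "\<dots> = f [] \<otimes> (g [] \<otimes> h (x # u)) \<oplus> (f [] \<otimes> conv ?g h u \<oplus> conv ?f (conv g h) u)"
    by (simp add: cl conv_add_left conv_smult_left Cons.IH m_assoc)
  also have "\<dots> = conv f (conv g h) (x # u)"
    by (simp add: cl conv_Cons r_distr a_assoc)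
  finally show ?case .
qed

lemma conv_one_left:
  assumes "\<And>u. f u \<in> carrier R"
  shows "conv (\<lambda>u. if u = [] then \<one> else \<zero>) f u = f u"
  using assms by (cases u) (simp_all add: conv_Nil conv_Cons conv_zero_left)

lemma conv_one_right:
  assumes "\<And>u. f u \<in> carrier R"
  shows "conv f (\<lambda>u. if u = [] then \<one> else \<zero>) u = f u"
  using assms by (induction u arbitrary: f) (simp_all add: conv_Nil conv_Cons)

lemma conv_eq_zero:
  assumes "\<And>u. f u \<in> carrier R" "\<And>u. g u \<in> carrier R"
    and "\<And>v w. u = v @ w \<Longrightarrow> f v = \<zero> \<or> g w = \<zero>"
  shows "conv f g u = \<zero>"
proof -
  have "f (take i u) \<otimes> g (drop i u) = \<zero>" for i
    using assms(3)[of "take i u" "drop i u"] assms(1,2) by auto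
  then show ?thesis unfolding conv_def by simp
qed

lemma conv_in_free_alg:
  assumes f: "f \<in> carrier (free_alg R S)" and g: "g \<in> carrier (free_alg R S)"
  shows "conv f g \<in> carrier (free_alg R S)"
proof -
  have "{u. conv f g u \<noteq> \<zero>} \<subseteq> (\<lambda>(v, w). v @ w) ` ({v. f v \<noteq> \<zero>} \<times> {w. g w \<noteq> \<zero>})"
  proof
    fix u assume "u \<in> {u. conv f g u \<noteq> \<zero>}"
    then have "\<exists>v w. u = v @ w \<and> f v \<noteq> \<zero> \<and> g w \<noteq> \<zero>"
      using conv_eq_zero[of f g u] f g by (auto simp: free_alg_simps)
    then show "u \<in> (\<lambda>(v, w). v @ w) ` ({v. f v \<noteq> \<zero>} \<times> {w. g w \<noteq> \<zero>})" by auto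
  qed
  then have "finite {u. conv f g u \<noteq> \<zero>}"
    by (rule finite_subset) (use f g in \<open>auto simp: free_alg_simps\<close>)
  moreover have "conv f g u = \<zero>" if "u \<notin> lists S" for u
    by (rule conv_eq_zero) (use f g that in \<open>auto simp: free_alg_simps\<close>)
  ultimately show ?thesis
    using f g by (auto simp: free_alg_simps intro!: conv_closed)
qed

lemma mult_free_alg: "f \<otimes>\<^bsub>free_alg R S\<^esub> g = conv f g"
  by (simp add: free_alg_simps conv_def fun_eq_iff)

lemma ring_free_alg: "ring (free_alg R S)"
proof (rule ringI)
  show "abelian_group (free_alg R S)"
  proof (rule abelian_groupI)
    fix f g assume "f \<in> carrier (free_alg R S)" "g \<in> carrier (free_alg R S)"
    moreover have "{u. f u \<oplus> g u \<noteq> \<zero>} \<subseteq> {u. f u \<noteq> \<zero>} \<union> {u. g u \<noteq> \<zero>}"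
      by auto
    ultimately show "f \<oplus>\<^bsub>free_alg R S\<^esub> g \<in> carrier (free_alg R S)"
      by (auto simp: free_alg_simps intro: finite_subset)
  next
    fix f assume f: "f \<in> carrier (free_alg R S)"
    then have "{u. \<ominus> f u \<noteq> \<zero>} \<subseteq> {u. f u \<noteq> \<zero>}" by auto
    with f have "(\<lambda>u. \<ominus> f u) \<in> carrier (free_alg R S)"
      by (auto simp: free_alg_simps intro: finite_subset)
    with f show "\<exists>g\<in>carrier (free_alg R S). g \<oplus>\<^bsub>free_alg R S\<^esub> f = \<zero>\<^bsub>free_alg R S\<^esub>"
      by (intro bexI[of _ "\<lambda>u. \<ominus> f u"]) (auto simp: free_alg_simps l_neg)
  qed (auto simp: free_alg_simps a_ac)
  show "monoid (free_alg R S)"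
  proof (rule monoidI)
    show "\<one>\<^bsub>free_alg R S\<^esub> \<in> carrier (free_alg R S)"
      by (auto simp: free_alg_simps)
  next
    fix f g h assume "f \<in> carrier (free_alg R S)" "g \<in> carrier (free_alg R S)" "h \<in> carrier (free_alg R S)"
    then show "f \<otimes>\<^bsub>free_alg R S\<^esub> g \<otimes>\<^bsub>free_alg R S\<^esub> h = f \<otimes>\<^bsub>free_alg R S\<^esub> (g \<otimes>\<^bsub>free_alg R S\<^esub> h)"
      by (simp only: mult_free_alg, intro ext conv_assoc) (auto simp: free_alg_simps)
  next
    fix f assume f: "f \<in> carrier (free_alg R S)"
    then show "\<one>\<^bsub>free_alg R S\<^esub> \<otimes>\<^bsub>free_alg R S\<^esub> f = f"
      by (simp only: mult_free_alg, simp only: free_alg_simps(3), intro ext conv_one_left)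
        (auto simp: free_alg_simps)
    show "f \<otimes>\<^bsub>free_alg R S\<^esub> \<one>\<^bsub>free_alg R S\<^esub> = f"
      using f by (simp only: mult_free_alg, simp only: free_alg_simps(3), intro ext conv_one_right)
        (auto simp: free_alg_simps)
  qed (simp add: mult_free_alg conv_in_free_alg)
next
  fix f g h assume "f \<in> carrier (free_alg R S)" "g \<in> carrier (free_alg R S)" "h \<in> carrier (free_alg R S)"
  then have cl: "\<And>u. f u \<in> carrier R" "\<And>u. g u \<in> carrier R" "\<And>u. h u \<in> carrier R"
    by (auto simp: free_alg_simps)
  then show "(f \<oplus>\<^bsub>free_alg R S\<^esub> g) \<otimes>\<^bsub>free_alg R S\<^esub> h =
      f \<otimes>\<^bsub>free_alg R S\<^esub> h \<oplus>\<^bsub>free_alg R S\<^esub> g \<otimes>\<^bsub>free_alg R S\<^esub> h"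
    "h \<otimes>\<^bsub>free_alg R S\<^esub> (f \<oplus>\<^bsub>free_alg R S\<^esub> g) =
      h \<otimes>\<^bsub>free_alg R S\<^esub> f \<oplus>\<^bsub>free_alg R S\<^esub> h \<otimes>\<^bsub>free_alg R S\<^esub> g"
    by (simp_all only: mult_free_alg free_alg_simps(5)) (auto simp: conv_add_left conv_add_right)
qed

lemma smult_free_alg_closed:
  assumes "c \<in> carrier R" "f \<in> carrier (free_alg R S)"
  shows "c \<odot>\<^bsub>free_alg R S\<^esub> f \<in> carrier (free_alg R S)"
proof -
  have "{u. c \<otimes> f u \<noteq> \<zero>} \<subseteq> {u. f u \<noteq> \<zero>}" using assms by auto
  with assms show ?thesis by (auto simp: free_alg_simps intro: finite_subset)
qed

lemma scalar_alg_free_alg: "scalar_alg R (free_alg R S)"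
proof -
  interpret F: ring "free_alg R S" by (rule ring_free_alg)
  show ?thesis
  proof unfold_locales
    fix c assume c: "c \<in> carrier R"
    show "c \<odot>\<^bsub>free_alg R S\<^esub> \<one>\<^bsub>free_alg R S\<^esub> \<in> carrier (free_alg R S)"
      using c by (rule smult_free_alg_closed) simp
    fix f assume f: "f \<in> carrier (free_alg R S)"
    then have cl: "f u \<in> carrier R" for u by (simp add: free_alg_simps)
    show "c \<odot>\<^bsub>free_alg R S\<^esub> f = c \<odot>\<^bsub>free_alg R S\<^esub> \<one>\<^bsub>free_alg R S\<^esub> \<otimes>\<^bsub>free_alg R S\<^esub> f"
      unfolding mult_free_alg using c cl
      by (simp only: free_alg_simps(3,6), subst fun_eq_iff)
        (simp only: conv_smult_left conv_one_left if_distrib[of "\<lambda>x. x \<in> _"] one_closed zero_closed if_cancel simp_thms)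
  qed
qed

lemma free_gen_closed: "x \<in> S \<Longrightarrow> free_gen R x \<in> carrier (free_alg R S)"
  by (auto simp: free_alg_simps free_gen_def)

text \<open>
  The linear extension of \<open>[x\<^sub>1, \<dots>] \<mapsto> [\<phi> x\<^sub>1, \<dots>]\<close>: an element is a coefficient
  function, so it is transported by pulling words back along the inverse of \<open>\<phi>\<close>.
\<close>

definition free_map :: "('x \<Rightarrow> 'y) \<Rightarrow> 'x set \<Rightarrow> ('x list \<Rightarrow> 'a) \<Rightarrow> 'y list \<Rightarrow> 'a" where
  "free_map \<phi> S f = (\<lambda>u. if u \<in> lists (\<phi> ` S) then f (map (inv_into S \<phi>) u) else \<zero>)"

lemma free_map_closed:
  assumes bij: "bij_betw \<phi> S T" and f: "f \<in> carrier (free_alg R S)"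
  shows "free_map \<phi> S f \<in> carrier (free_alg R T)"
proof -
  have T: "T = \<phi> ` S" using bij by (simp add: bij_betw_def)
  have "{u. free_map \<phi> S f u \<noteq> \<zero>} \<subseteq> map \<phi> ` {u. f u \<noteq> \<zero>}"
  proof
    fix u assume u: "u \<in> {u. free_map \<phi> S f u \<noteq> \<zero>}"
    then have "u \<in> lists (\<phi> ` S)" "f (map (inv_into S \<phi>) u) \<noteq> \<zero>"
      by (auto simp: free_map_def split: if_splits)
    moreover from this have "map \<phi> (map (inv_into S \<phi>) u) = u"
      by (auto simp: in_lists_conv_set f_inv_into_f intro!: map_idI)
    ultimately show "u \<in> map \<phi> ` {u. f u \<noteq> \<zero>}"
      by (metis (mono_tags) image_eqI mem_Collect_eq)
  qed
  then have "finite {u. free_map \<phi> S f u \<noteq> \<zero>}"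
    by (rule finite_subset) (use f in \<open>simp add: free_alg_simps\<close>)
  then show ?thesis using f T
    by (simp add: free_alg_simps) (simp add: free_map_def)
qed

lemma free_map_gen:
  assumes bij: "bij_betw \<phi> S T" and x: "x \<in> S"
  shows "free_map \<phi> S (free_gen R x) = free_gen R (\<phi> x)"
proof
  fix u
  have inj: "inj_on \<phi> S" using bij by (simp add: bij_betw_def)
  have "(u \<in> lists (\<phi> ` S) \<and> map (inv_into S \<phi>) u = [x]) \<longleftrightarrow> u = [\<phi> x]"
    using x inj by (auto simp: map_eq_Cons_conv inv_into_f_f)
  then show "free_map \<phi> S (free_gen R x) u = free_gen R (\<phi> x) u"
    by (auto simp: free_map_def free_gen_def)
qed

lemma free_map_conv:
  assumes f: "f \<in> carrier (free_alg R S)" and g: "g \<in> carrier (free_alg R S)"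
  shows "free_map \<phi> S (conv f g) = conv (free_map \<phi> S f) (free_map \<phi> S g)"
proof
  fix u
  have cl: "f v \<in> carrier R" "g v \<in> carrier R" for v
    using f g by (auto simp: free_alg_simps)
  show "free_map \<phi> S (conv f g) u = conv (free_map \<phi> S f) (free_map \<phi> S g) u"
  proof (cases "u \<in> lists (\<phi> ` S)")
    case True
    then have "take i u \<in> lists (\<phi> ` S)" "drop i u \<in> lists (\<phi> ` S)" for i
      by (auto simp: in_lists_conv_set dest: in_set_takeD in_set_dropD)
    with True show ?thesis
      by (simp add: free_map_def conv_def take_map drop_map)
  next
    case False
    then have "conv (free_map \<phi> S f) (free_map \<phi> S g) u = \<zero>"
      using cl by (intro conv_eq_zero) (auto simp: free_map_def)
    with False show ?thesis by (simp add: free_map_def)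
  qed
qed

lemma free_map_alg_iso:
  assumes bij: "bij_betw \<phi> S T"
  shows "free_map \<phi> S \<in> alg_iso R (free_alg R S) (free_alg R T)"
proof -
  have T: "T = \<phi> ` S" and inj: "inj_on \<phi> S" using bij by (auto simp: bij_betw_def)
  have lift: "free_map \<phi> S f (map \<phi> u) = f u" if "u \<in> lists S" for f u
  proof -
    have "map (inv_into S \<phi>) (map \<phi> u) = u"
      using that inj by (auto simp: in_lists_conv_set intro!: map_idI)
    with that show ?thesis by (auto simp: free_map_def)
  qed
  have "free_map \<phi> S \<in> ring_iso (free_alg R S) (free_alg R T)"
  proof (rule ring_iso_memI)
    show "bij_betw (free_map \<phi> S) (carrier (free_alg R S)) (carrier (free_alg R T))"
    proof (rule bij_betw_imageI)
      show "inj_on (free_map \<phi> S) (carrier (free_alg R S))"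
      proof (rule inj_onI)
        fix f g assume fg: "f \<in> carrier (free_alg R S)" "g \<in> carrier (free_alg R S)"
          "free_map \<phi> S f = free_map \<phi> S g"
        show "f = g"
        proof
          fix u show "f u = g u"
            using fg lift[of u f] lift[of u g] by (cases "u \<in> lists S") (auto simp: free_alg_simps)
        qed
      qed
      show "free_map \<phi> S ` carrier (free_alg R S) = carrier (free_alg R T)"
      proof
        show "free_map \<phi> S ` carrier (free_alg R S) \<subseteq> carrier (free_alg R T)"
          using free_map_closed[OF bij] by auto
        show "carrier (free_alg R T) \<subseteq> free_map \<phi> S ` carrier (free_alg R S)"
        proof
          fix g assume g: "g \<in> carrier (free_alg R T)"
          let ?f = "free_map (inv_into S \<phi>) T g"
          have "free_map \<phi> S ?f = g"
          proof
            fix u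
            show "free_map \<phi> S ?f u = g u"
            proof (cases "u \<in> lists T")
              case True
              have inv: "bij_betw (inv_into S \<phi>) T S" by (rule bij_betw_inv_into[OF bij])
              have "map (inv_into T (inv_into S \<phi>)) (map (inv_into S \<phi>) u) = u"
                using True inv by (auto simp: in_lists_conv_set bij_betw_def intro!: map_idI)
              moreover have "map (inv_into S \<phi>) u \<in> lists (inv_into S \<phi> ` T)"
                using True by auto
              ultimately show ?thesis
                using True T by (simp add: free_map_def)
            qed (use g T in \<open>auto simp: free_map_def free_alg_simps\<close>)
          qed
          then show "g \<in> free_map \<phi> S ` carrier (free_alg R S)"
            using free_map_closed[OF bij_betw_inv_into[OF bij] g] by (metis image_eqI)
        qed
      qed
    qed
    show "free_map \<phi> S \<one>\<^bsub>free_alg R S\<^esub> = \<one>\<^bsub>free_alg R T\<^esub>"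
      by (auto simp: free_alg_simps free_map_def fun_eq_iff)
  qed (auto simp: free_map_closed[OF bij] mult_free_alg free_map_conv,
       auto simp: free_alg_simps free_map_def)
  then show ?thesis
    by (auto simp: alg_iso_def free_map_def free_alg_simps)
qed

end

section \<open>Enveloping algebras of isomorphic Lie algebras\<close>

definition lie_iso ::
    "('a, 'm) ring_scheme \<Rightarrow> ('a, 'b) lie_alg \<Rightarrow> ('a, 'c) lie_alg \<Rightarrow> ('b \<Rightarrow> 'c) set" where
  "lie_iso R L M =
    {\<phi>. bij_betw \<phi> (carrier L) (carrier M) \<and>
        (\<forall>x\<in>carrier L. \<forall>y\<in>carrier L. \<phi> (x \<oplus>\<^bsub>L\<^esub> y) = \<phi> x \<oplus>\<^bsub>M\<^esub> \<phi> y) \<and>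
        (\<forall>c\<in>carrier R. \<forall>x\<in>carrier L. \<phi> (c \<odot>\<^bsub>L\<^esub> x) = c \<odot>\<^bsub>M\<^esub> \<phi> x) \<and>
        (\<forall>x\<in>carrier L. \<forall>y\<in>carrier L. \<phi> (lie_bracket L x y) = lie_bracket M (\<phi> x) (\<phi> y))}"

text \<open>
  The record of a Lie algebra carries bare operations.  Its defining relations lie in the free algebra
  on the carrier only if the carrier is closed under them.
\<close>

definition lie_closed :: "('a, 'm) ring_scheme \<Rightarrow> ('a, 'b) lie_alg \<Rightarrow> bool" where
  "lie_closed R L \<longleftrightarrow>
    (\<forall>x\<in>carrier L. \<forall>y\<in>carrier L. x \<oplus>\<^bsub>L\<^esub> y \<in> carrier L \<and> lie_bracket L x y \<in> carrier L) \<and>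
    (\<forall>c\<in>carrier R. \<forall>x\<in>carrier L. c \<odot>\<^bsub>L\<^esub> x \<in> carrier L)"

lemma ring_hom_minus:
  assumes "ring A" "ring B" "h \<in> ring_hom A B" "x \<in> carrier A" "y \<in> carrier A"
  shows "h (x \<ominus>\<^bsub>A\<^esub> y) = h x \<ominus>\<^bsub>B\<^esub> h y"
proof -
  interpret ring_hom_ring A B h by (rule ring_hom_ringI2) fact+
  show ?thesis using assms by (simp add: a_minus_def)
qed

context ring
begin

lemma ue_relations_closed:
  assumes L: "lie_closed R L"
  shows "ue_relations R L \<subseteq> carrier (free_alg R (carrier L))"
proof -
  interpret F: scalar_alg R "free_alg R (carrier L)" by (rule scalar_alg_free_alg)
  show ?thesis
    using L by (auto simp: ue_relations_def Let_def lie_closed_def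
      intro!: F.minus_closed F.a_closed F.m_closed F.smult_closed free_gen_closed)
qed

lemma scalar_alg_univ_env:
  assumes "lie_closed R L"
  shows "scalar_alg R (univ_env R L)"
proof -
  interpret F: scalar_alg R "free_alg R (carrier L)" by (rule scalar_alg_free_alg)
  show ?thesis
    unfolding univ_env_def ue_ideal_def
    by (intro F.scalar_alg_alg_quot F.genideal_ideal ue_relations_closed assms)
qed

text \<open>
  Each of the three families of relations is parametrised by elements of the Lie algebra (and
  scalars), and the induced map of free algebras takes the relation with given parameters to the
  relation with parameters transported by \<open>\<phi>\<close>.  As \<open>\<phi>\<close> is onto, every relation arises.
\<close>

lemma ue_relations_image:
  assumes L: "lie_closed R L" and \<phi>: "\<phi> \<in> lie_iso R L M"
  shows "free_map \<phi> (carrier L) ` ue_relations R L = ue_relations R M"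
proof -
  let ?h = "free_map \<phi> (carrier L)"
  let ?g = "free_gen R"
  let ?F = "free_alg R (carrier L)" and ?G = "free_alg R (carrier M)"
  interpret F: scalar_alg R ?F by (rule scalar_alg_free_alg)
  interpret G: scalar_alg R ?G by (rule scalar_alg_free_alg)
  have bij: "bij_betw \<phi> (carrier L) (carrier M)"
    using \<phi> by (simp add: lie_iso_def)
  have iso: "?h \<in> alg_iso R ?F ?G" by (rule free_map_alg_iso[OF bij])
  then have hom: "?h \<in> ring_hom ?F ?G" by (simp add: alg_iso_def ring_iso_def)
  have hs: "?h (c \<odot>\<^bsub>?F\<^esub> a) = c \<odot>\<^bsub>?G\<^esub> ?h a" if "c \<in> carrier R" "a \<in> carrier ?F" for a c
    using iso that by (auto simp: alg_iso_def)
  note hm = ring_hom_minus[OF F.ring_axioms G.ring_axioms hom]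
  note [simp] = hm hs ring_hom_add[OF hom] ring_hom_mult[OF hom] free_gen_closed
    free_map_gen[OF bij] F.smult_closed
  have cl: "x \<oplus>\<^bsub>L\<^esub> y \<in> carrier L" "lie_bracket L x y \<in> carrier L"
    if "x \<in> carrier L" "y \<in> carrier L" for x y
    using L that by (auto simp: lie_closed_def)
  have cls: "c \<odot>\<^bsub>L\<^esub> x \<in> carrier L" if "c \<in> carrier R" "x \<in> carrier L" for c x
    using L that by (auto simp: lie_closed_def)
  have pa: "\<phi> (x \<oplus>\<^bsub>L\<^esub> y) = \<phi> x \<oplus>\<^bsub>M\<^esub> \<phi> y"
      "\<phi> (lie_bracket L x y) = lie_bracket M (\<phi> x) (\<phi> y)"
    if "x \<in> carrier L" "y \<in> carrier L" for x y
    using \<phi> that by (auto simp: lie_iso_def)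
  have ps: "\<phi> (c \<odot>\<^bsub>L\<^esub> x) = c \<odot>\<^bsub>M\<^esub> \<phi> x" if "c \<in> carrier R" "x \<in> carrier L" for c x
    using \<phi> that by (auto simp: lie_iso_def)
  have M: "carrier M = \<phi> ` carrier L" using bij by (simp add: bij_betw_def)
  let ?a = "\<lambda>L F x y. ?g (x \<oplus>\<^bsub>L\<^esub> y) \<ominus>\<^bsub>F\<^esub> (?g x \<oplus>\<^bsub>F\<^esub> ?g y)"
  let ?s = "\<lambda>L F c x. ?g (c \<odot>\<^bsub>L\<^esub> x) \<ominus>\<^bsub>F\<^esub> (c \<odot>\<^bsub>F\<^esub> ?g x)"
  let ?b = "\<lambda>L F x y. (?g x \<otimes>\<^bsub>F\<^esub> ?g y \<ominus>\<^bsub>F\<^esub> ?g y \<otimes>\<^bsub>F\<^esub> ?g x) \<ominus>\<^bsub>F\<^esub> ?g (lie_bracket L x y)"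
  have rel: "ue_relations R N =
      (\<lambda>(x, y). ?a N (free_alg R (carrier N)) x y) ` (carrier N \<times> carrier N) \<union>
      (\<lambda>(c, x). ?s N (free_alg R (carrier N)) c x) ` (carrier R \<times> carrier N) \<union>
      (\<lambda>(x, y). ?b N (free_alg R (carrier N)) x y) ` (carrier N \<times> carrier N)"
    for N :: "('a, 'z) lie_alg"
    by (auto simp: ue_relations_def Let_def)
  have MM: "carrier M \<times> carrier M = map_prod \<phi> \<phi> ` (carrier L \<times> carrier L)"
    "carrier R \<times> carrier M = map_prod id \<phi> ` (carrier R \<times> carrier L)"
    using M by (auto simp: map_prod_surj_on)
  show ?thesis
    unfolding rel image_Un MM(1) MM(2) image_image
    by (intro arg_cong2[where f="(\<union>)"] image_cong refl)
      (auto simp: cl cls pa[symmetric] ps[symmetric])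
qed

lemma univ_env_alg_iso:
  assumes L: "lie_closed R L" and M: "lie_closed R M" and \<phi>: "\<phi> \<in> lie_iso R L M"
  obtains H where "H \<in> alg_iso R (univ_env R L) (univ_env R M)"
    and "\<And>x. x \<in> carrier L \<Longrightarrow> H (ue_incl R L x) = ue_incl R M (\<phi> x)"
proof
  let ?h = "free_map \<phi> (carrier L)"
  let ?F = "free_alg R (carrier L)" and ?G = "free_alg R (carrier M)"
  interpret F: scalar_alg R ?F by (rule scalar_alg_free_alg)
  interpret G: scalar_alg R ?G by (rule scalar_alg_free_alg)
  have bij: "bij_betw \<phi> (carrier L) (carrier M)"
    using \<phi> by (simp add: lie_iso_def)
  have iso: "?h \<in> alg_iso R ?F ?G" by (rule free_map_alg_iso[OF bij])
  then have iso': "?h \<in> ring_iso ?F ?G" by (simp add: alg_iso_def)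
  then have hom: "?h \<in> ring_hom ?F ?G" by (simp add: ring_iso_def)
  note relL = ue_relations_closed[OF L]
  note rim = ue_relations_image[OF L \<phi>]
  show "(\<lambda>C. ?h ` C) \<in> alg_iso R (univ_env R L) (univ_env R M)"
    using alg_iso_quotient[OF F.scalar_alg_axioms G.scalar_alg_axioms iso relL]
    unfolding univ_env_def ue_ideal_def rim .
  interpret I: ideal "ue_ideal R L" ?F
    unfolding ue_ideal_def by (rule F.genideal_ideal[OF relL])
  have "?h ` ue_ideal R L = ue_ideal R M"
    using genideal_image[OF F.ring_axioms G.ring_axioms iso' relL] by (simp add: ue_ideal_def rim)
  then show "?h ` ue_incl R L x = ue_incl R M (\<phi> x)" if "x \<in> carrier L" for x
    using coset_image[OF hom I.a_subset free_gen_closed[OF that]] free_map_gen[OF bij that]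
    by (simp add: ue_incl_def)
qed

end

section \<open>The action of unimodular integer matrices\<close>

text \<open>
  The matrix with rows \<open>(s, t)\<close> and \<open>(a, b)\<close>.  When its determinant is \<open>1\<close>, its inverse
  has rows \<open>(b, - t)\<close> and \<open>(- a, s)\<close>.
\<close>

definition mat_act :: "int \<Rightarrow> int \<Rightarrow> int \<Rightarrow> int \<Rightarrow> int \<times> int \<Rightarrow> int \<times> int" where
  "mat_act s t a b = (\<lambda>(r, n). (s * r + t * n, a * r + b * n))"

lemma mat_act_inverse:
  assumes "s * b - t * a = 1"
  shows "mat_act b (- t) (- a) s (mat_act s t a b x) = x"
    and "mat_act s t a b (mat_act b (- t) (- a) s x) = x"
proof -
  obtain r n where x: "x = (r, n)" by fastforce
  have "b * (s * r + t * n) - t * (a * r + b * n) = (s * b - t * a) * r"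
    "s * (a * r + b * n) - a * (s * r + t * n) = (s * b - t * a) * n"
    "s * (b * r - t * n) + t * (s * n - a * r) = (s * b - t * a) * r"
    "a * (b * r - t * n) + b * (s * n - a * r) = (s * b - t * a) * n"
    by (simp_all add: algebra_simps)
  then show "mat_act b (- t) (- a) s (mat_act s t a b x) = x"
    and "mat_act s t a b (mat_act b (- t) (- a) s x) = x"
    by (simp_all add: x mat_act_def assms)
qed

lemma mat_act_add: "mat_act s t a b (x + y) = mat_act s t a b x + mat_act s t a b y"
  by (cases x; cases y) (simp add: mat_act_def algebra_simps)

lemma mat_act_uminus: "mat_act s t a b (- x) = - mat_act s t a b x"
  by (cases x) (simp add: mat_act_def)

lemma mat_act_zero [simp]: "mat_act s t a b 0 = 0"
  by (simp add: mat_act_def zero_prod_def)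

lemma det2_mat_act:
  assumes "s * b - t * a = 1"
  shows "det2 (mat_act s t a b x) (mat_act s t a b y) = det2 x y"
proof -
  obtain r n r' n' where xy: "x = (r, n)" "y = (r', n')" by fastforce
  have "det2 (mat_act s t a b x) (mat_act s t a b y) = (s * b - t * a) * det2 x y"
    by (simp add: xy mat_act_def det2_def algebra_simps)
  then show ?thesis by (simp add: assms)
qed

section \<open>The elliptic Hall Lie algebra\<close>

lemma eh_module_simps:
  "carrier (eh_module R) =
    {f. (\<forall>x. f x \<in> carrier R) \<and> finite {x. f x \<noteq> \<zero>\<^bsub>R\<^esub>} \<and> f 0 = \<zero>\<^bsub>R\<^esub>} \<times> (carrier R \<times> carrier R)"
  "\<zero>\<^bsub>eh_module R\<^esub> = (\<lambda>x. \<zero>\<^bsub>R\<^esub>, (\<zero>\<^bsub>R\<^esub>, \<zero>\<^bsub>R\<^esub>))"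
  "(f, (a, b)) \<oplus>\<^bsub>eh_module R\<^esub> (g, (c, d)) = (\<lambda>x. f x \<oplus>\<^bsub>R\<^esub> g x, (a \<oplus>\<^bsub>R\<^esub> c, b \<oplus>\<^bsub>R\<^esub> d))"
  "r \<odot>\<^bsub>eh_module R\<^esub> (f, (a, b)) = (\<lambda>x. r \<otimes>\<^bsub>R\<^esub> f x, (r \<otimes>\<^bsub>R\<^esub> a, r \<otimes>\<^bsub>R\<^esub> b))"
  by (simp_all add: eh_module_def)

lemma eh_lie_simps [simp]:
  "carrier (eh_lie R q) = carrier (eh_module R)"
  "x \<oplus>\<^bsub>eh_lie R q\<^esub> y = x \<oplus>\<^bsub>eh_module R\<^esub> y"
  "c \<odot>\<^bsub>eh_lie R q\<^esub> x = c \<odot>\<^bsub>eh_module R\<^esub> x"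
  "lie_bracket (eh_lie R q) = eh_bracket R q"
  by (simp_all add: eh_lie_def module.defs lie_alg.defs)

lemma finsum_additive:
  assumes "abelian_monoid M" "abelian_monoid N" "finite S"
    and closed: "\<And>x. x \<in> carrier M \<Longrightarrow> \<phi> x \<in> carrier N"
    and add: "\<And>x y. x \<in> carrier M \<Longrightarrow> y \<in> carrier M \<Longrightarrow> \<phi> (x \<oplus>\<^bsub>M\<^esub> y) = \<phi> x \<oplus>\<^bsub>N\<^esub> \<phi> y"
    and zero: "\<phi> \<zero>\<^bsub>M\<^esub> = \<zero>\<^bsub>N\<^esub>"
    and f: "\<And>i. i \<in> S \<Longrightarrow> f i \<in> carrier M"
  shows "\<phi> (finsum M f S) = finsum N (\<lambda>i. \<phi> (f i)) S"
proof -
  interpret M: abelian_monoid M by fact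
  interpret N: abelian_monoid N by fact
  from \<open>finite S\<close> f show ?thesis
    by (induction S) (simp_all add: zero add closed Pi_def)
qed

context cring
begin

lemma eh_coeff_closed: "u \<in> carrier (eh_module R) \<Longrightarrow> fst u x \<in> carrier R"
  by (auto simp: eh_module_simps simp del: split_paired_All)

lemma abelian_monoid_eh_module: "abelian_monoid (eh_module R)"
proof (rule abelian_monoidI)
  fix u v assume uv: "u \<in> carrier (eh_module R)" "v \<in> carrier (eh_module R)"
  have "{x. fst u x \<oplus> fst v x \<noteq> \<zero>} \<subseteq> {x. fst u x \<noteq> \<zero>} \<union> {x. fst v x \<noteq> \<zero>}" by auto
  moreover have "finite ({x. fst u x \<noteq> \<zero>} \<union> {x. fst v x \<noteq> \<zero>})"
    using uv by (auto simp: eh_module_simps)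
  ultimately have "finite {x. fst u x \<oplus> fst v x \<noteq> \<zero>}"
    by (rule finite_subset)
  then show "u \<oplus>\<^bsub>eh_module R\<^esub> v \<in> carrier (eh_module R)"
    using uv by (cases u; cases v) (auto simp: eh_module_simps)
qed (auto simp: eh_module_simps a_ac fun_eq_iff simp del: split_paired_All)

lemma eh_smult_closed:
  assumes c: "c \<in> carrier R" and u: "u \<in> carrier (eh_module R)"
  shows "c \<odot>\<^bsub>eh_module R\<^esub> u \<in> carrier (eh_module R)"
proof -
  have "{x. c \<otimes> fst u x \<noteq> \<zero>} \<subseteq> {x. fst u x \<noteq> \<zero>}" using c by auto
  moreover have "finite {x. fst u x \<noteq> \<zero>}" using u by (auto simp: eh_module_simps)
  ultimately have "finite {x. c \<otimes> fst u x \<noteq> \<zero>}" by (rule finite_subset)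
  then show ?thesis
    using c u by (cases u) (auto simp: eh_module_simps)
qed

lemma eh_w_closed: "eh_w R x \<in> carrier (eh_module R)"
  by (auto simp: eh_w_def eh_module_simps)

lemma eh_central_closed: "eh_central R x \<in> carrier (eh_module R)"
  by (auto simp: eh_central_def eh_module_simps)

lemma eh_w_bracket_closed:
  assumes q: "\<And>d. qdiff R q d \<in> carrier R"
  shows "eh_w_bracket R q x y \<in> carrier (eh_module R)"
proof -
  interpret E: abelian_monoid "eh_module R" by (rule abelian_monoid_eh_module)
  show ?thesis
    by (simp add: eh_w_bracket_def q eh_smult_closed eh_w_closed eh_central_closed)
qed

lemma eh_bracket_closed:
  assumes q: "\<And>d. qdiff R q d \<in> carrier R"
    and u: "u \<in> carrier (eh_module R)" and v: "v \<in> carrier (eh_module R)"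
  shows "eh_bracket R q u v \<in> carrier (eh_module R)"
proof -
  interpret E: abelian_monoid "eh_module R" by (rule abelian_monoid_eh_module)
  have "fst u x \<in> carrier R" "fst v x \<in> carrier R" for x
    using u v by (simp_all add: eh_coeff_closed)
  then show ?thesis
    unfolding eh_bracket_def
    by (intro E.finsum_closed Pi_I) (simp add: eh_smult_closed eh_w_bracket_closed q)
qed

lemma lie_closed_eh_lie:
  assumes "\<And>d. qdiff R q d \<in> carrier R"
  shows "lie_closed R (eh_lie R q)"
proof -
  interpret E: abelian_monoid "eh_module R" by (rule abelian_monoid_eh_module)
  show ?thesis
    by (auto simp: lie_closed_def eh_bracket_closed assms eh_smult_closed simp del: prod.collapse)
qed

abbreviation of_integer :: "int \<Rightarrow> 'a" where
  "of_integer k \<equiv> [k] \<cdot> \<one>"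

lemma of_integer_add: "of_integer (j + k) = of_integer j \<oplus> of_integer k"
  by (simp add: add.int_pow_mult)

lemma of_integer_mult: "of_integer (j * k) = of_integer j \<otimes> of_integer k"
  by (simp add: add_pow_ldistr_int add.int_pow_pow mult.commute)

text \<open>
  The linear map with \<open>w x \<mapsto> w (g x)\<close> and \<open>x \<mapsto> g x\<close> on central elements.  The
  coefficient of \<open>w x\<close> in the image is the one of \<open>w (g\<^sup>-\<^sup>1 x)\<close> in the argument, whence
  the inverse matrix in the first component and \<open>g\<close> itself in the second.
\<close>

definition eh_twist :: "int \<Rightarrow> int \<Rightarrow> int \<Rightarrow> int \<Rightarrow> 'a eh_elem \<Rightarrow> 'a eh_elem" where
  "eh_twist s t a b = (\<lambda>(f, (\<alpha>, \<beta>)). (f \<circ> mat_act b (- t) (- a) s,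
    (of_integer s \<otimes> \<alpha> \<oplus> of_integer t \<otimes> \<beta>, of_integer a \<otimes> \<alpha> \<oplus> of_integer b \<otimes> \<beta>)))"

lemma eh_twist_add:
  assumes "u \<in> carrier (eh_module R)" "v \<in> carrier (eh_module R)"
  shows "eh_twist s t a b (u \<oplus>\<^bsub>eh_module R\<^esub> v) = eh_twist s t a b u \<oplus>\<^bsub>eh_module R\<^esub> eh_twist s t a b v"
  using assms by (cases u; cases v) (auto simp: eh_twist_def eh_module_simps r_distr a_ac)

lemma eh_twist_smult:
  assumes "c \<in> carrier R" "u \<in> carrier (eh_module R)"
  shows "eh_twist s t a b (c \<odot>\<^bsub>eh_module R\<^esub> u) = c \<odot>\<^bsub>eh_module R\<^esub> eh_twist s t a b u"
  using assms by (cases u) (auto simp: eh_twist_def eh_module_simps r_distr m_lcomm)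

lemma eh_twist_zero: "eh_twist s t a b \<zero>\<^bsub>eh_module R\<^esub> = \<zero>\<^bsub>eh_module R\<^esub>"
  by (simp add: eh_twist_def eh_module_simps comp_def)

lemma eh_twist_central: "eh_twist s t a b (eh_central R x) = eh_central R (mat_act s t a b x)"
  by (cases x)
    (simp add: eh_twist_def eh_central_def mat_act_def comp_def of_integer_add of_integer_mult)

context
  fixes s t a b :: int
  assumes det: "s * b - t * a = 1"
begin

lemma inj_mat_act: "inj_on (mat_act s t a b) A"
  by (rule inj_on_inverseI) (rule mat_act_inverse(1)[OF det])

lemma mat_act_eq_iff: "mat_act s t a b x = mat_act s t a b y \<longleftrightarrow> x = y"
  using inj_mat_act[of UNIV] by (simp add: inj_eq)

lemma mat_act_inverse_eq_iff: "mat_act b (- t) (- a) s y = x \<longleftrightarrow> y = mat_act s t a b x"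
  using mat_act_inverse[OF det] by metis

lemma eh_twist_support:
  "{x. fst (eh_twist s t a b u) x \<noteq> \<zero>} = mat_act s t a b ` {x. fst u x \<noteq> \<zero>}"
proof -
  have "fst (eh_twist s t a b u) x = fst u (mat_act b (- t) (- a) s x)" for x
    by (cases u) (simp add: eh_twist_def)
  then show ?thesis
    using mat_act_inverse[OF det] by (auto simp: image_iff simp del: split_paired_All split_paired_Ex) metis
qed

lemma eh_twist_closed:
  assumes u: "u \<in> carrier (eh_module R)"
  shows "eh_twist s t a b u \<in> carrier (eh_module R)"
proof -
  have "finite {x. fst (eh_twist s t a b u) x \<noteq> \<zero>}"
    unfolding eh_twist_support using u by (auto simp: eh_module_simps)
  then show ?thesis
    using u
    by (cases u) (auto simp: eh_module_simps eh_twist_def simp del: split_paired_All)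
qed

lemma eh_twist_w: "eh_twist s t a b (eh_w R x) = eh_w R (mat_act s t a b x)"
  using mat_act_eq_iff[of x 0]
  by (auto simp: eh_twist_def eh_w_def comp_def mat_act_inverse_eq_iff)

text \<open>
  Here the determinant of \<open>g\<close> matters: \<open>det (g x, g y) = det (x, y)\<close>, so the coefficient
  of \<open>w (x + y)\<close> is unchanged.
\<close>

lemma eh_twist_w_bracket:
  assumes q: "\<And>d. qdiff R q d \<in> carrier R"
  shows "eh_twist s t a b (eh_w_bracket R q x y) = eh_w_bracket R q (mat_act s t a b x) (mat_act s t a b y)"
proof -
  interpret E: abelian_monoid "eh_module R" by (rule abelian_monoid_eh_module)
  have "x = - y \<longleftrightarrow> mat_act s t a b x = - mat_act s t a b y"
    by (simp add: mat_act_uminus[symmetric] mat_act_eq_iff)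
  then show ?thesis
    by (simp add: eh_w_bracket_def eh_twist_add eh_twist_smult eh_twist_zero eh_twist_w
        eh_twist_central q eh_smult_closed eh_w_closed eh_central_closed det2_mat_act[OF det]
        mat_act_add)
qed

text \<open>
  The bracket is a sum over the supports of its arguments, and the twist moves supports by \<open>g\<close>;
  reindexing along \<open>g\<close> reduces the claim to the brackets of the \<open>w x\<close>.
\<close>

lemma eh_twist_bracket:
  assumes q: "\<And>d. qdiff R q d \<in> carrier R"
    and u: "u \<in> carrier (eh_module R)" and v: "v \<in> carrier (eh_module R)"
  shows "eh_twist s t a b (eh_bracket R q u v) = eh_bracket R q (eh_twist s t a b u) (eh_twist s t a b v)"
proof -
  interpret E: abelian_monoid "eh_module R" by (rule abelian_monoid_eh_module)
  let ?g = "mat_act s t a b" and ?\<phi> = "eh_twist s t a b"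
  let ?U = "{x. fst u x \<noteq> \<zero>}" and ?V = "{x. fst v x \<noteq> \<zero>}"
  have fin: "finite ?U" "finite ?V"
    using u v by (auto simp: eh_module_simps)
  have cl: "fst u x \<in> carrier R" "fst v x \<in> carrier R" for x
    using u v by (simp_all add: eh_coeff_closed)
  note clo = cl q eh_smult_closed eh_w_bracket_closed eh_twist_closed
  have ev: "fst (?\<phi> w) (?g x) = fst w x" for w x
    by (cases w) (simp add: eh_twist_def mat_act_inverse[OF det])
  note hom = finsum_additive[OF E.abelian_monoid_axioms E.abelian_monoid_axioms _
      eh_twist_closed eh_twist_add eh_twist_zero]
  have "eh_bracket R q (?\<phi> u) (?\<phi> v) =
      (\<Oplus>\<^bsub>eh_module R\<^esub>x\<in>?U. \<Oplus>\<^bsub>eh_module R\<^esub>y\<in>?V.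
        (fst u x \<otimes> fst v y) \<odot>\<^bsub>eh_module R\<^esub> eh_w_bracket R q (?g x) (?g y))"
  proof -
    have cl': "fst (?\<phi> u) x \<in> carrier R" "fst (?\<phi> v) x \<in> carrier R" for x
      using u v by (simp_all add: eh_twist_closed eh_coeff_closed)
    show ?thesis
      unfolding eh_bracket_def eh_twist_support
      by (simp add: E.finsum_reindex inj_mat_act Pi_def clo cl' ev E.finsum_closed)
  qed
  also have "\<dots> = (\<Oplus>\<^bsub>eh_module R\<^esub>x\<in>?U. ?\<phi> (\<Oplus>\<^bsub>eh_module R\<^esub>y\<in>?V.
        (fst u x \<otimes> fst v y) \<odot>\<^bsub>eh_module R\<^esub> eh_w_bracket R q x y))"
    by (simp add: hom fin clo eh_twist_smult eh_twist_w_bracket)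
  also have "\<dots> = ?\<phi> (eh_bracket R q u v)"
    unfolding eh_bracket_def
    by (subst hom) (auto simp: fin clo Pi_def intro!: E.finsum_closed)
  finally show ?thesis by simp
qed

text \<open>
  The twist by \<open>g\<close> is undone by the twist by \<open>g\<^sup>-\<^sup>1\<close>; on the central part this is the
  product of the two matrices, computed in the integers and then mapped to the ring.
\<close>

lemma eh_twist_inverse:
  assumes u: "u \<in> carrier (eh_module R)"
  shows "eh_twist b (- t) (- a) s (eh_twist s t a b u) = u"
proof -
  obtain f \<alpha> \<beta> where u': "u = (f, (\<alpha>, \<beta>))" by (metis prod.collapse)
  have ab: "\<alpha> \<in> carrier R" "\<beta> \<in> carrier R" using u by (auto simp: u' eh_module_simps)
  have *: "of_integer i \<otimes> (of_integer j \<otimes> \<alpha> \<oplus> of_integer k \<otimes> \<beta>) \<oplus>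
        of_integer i' \<otimes> (of_integer j' \<otimes> \<alpha> \<oplus> of_integer k' \<otimes> \<beta>) =
      of_integer (i * j + i' * j') \<otimes> \<alpha> \<oplus> of_integer (i * k + i' * k') \<otimes> \<beta>" for i j k i' j' k'
    unfolding of_integer_add of_integer_mult using ab
    by (simp add: r_distr l_distr m_assoc a_ac)
  have e: "b * s + (- t) * a = 1" "b * t + (- t) * b = 0"
    "(- a) * s + s * a = 0" "(- a) * t + s * b = 1"
    using det by (simp_all add: algebra_simps)
  have "f \<circ> mat_act b (- t) (- a) s \<circ> mat_act s t a b = f"
    using mat_act_inverse[OF det] by (auto simp: fun_eq_iff)
  moreover have "of_integer 0 = \<zero>" "of_integer 1 = \<one>"
    by (simp add: add_pow_def) (rule add.int_pow_1, simp)
  ultimately show ?thesis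
    unfolding u' eh_twist_def prod.case * e using ab by simp
qed

end

lemma eh_twist_lie_iso:
  assumes det: "s * b - t * a = 1" and q: "\<And>d. qdiff R q d \<in> carrier R"
  shows "eh_twist s t a b \<in> lie_iso R (eh_lie R q) (eh_lie R q)"
proof -
  have det': "b * s - (- t) * (- a) = 1" using det by (simp add: algebra_simps)
  have "bij_betw (eh_twist s t a b) (carrier (eh_module R)) (carrier (eh_module R))"
    by (rule bij_betw_byWitness[where f' = "eh_twist b (- t) (- a) s"])
      (use eh_twist_inverse[OF det] eh_twist_inverse[OF det'] eh_twist_closed[OF det]
        eh_twist_closed[OF det'] in auto)
  then show ?thesis
    by (simp add: lie_iso_def eh_twist_add eh_twist_smult eh_twist_bracket[OF det q])
qed

text \<open>
  The hypothesis says \<open>\<lambda>' \<circ> g = \<lambda>\<close>.  The automorphism of the enveloping algebra induced by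
  \<open>g\<close> sends the generator \<open>x - \<lambda>(x)\<close> of the first ideal to \<open>g x - \<lambda>'(g x)\<close>, and
  \<open>g x\<close> runs through the whole lattice, so the two generating sets correspond.
\<close>

lemma EH_alg_iso:
  assumes q: "\<And>d. qdiff R q d \<in> carrier R" and det: "s * b - t * a = 1"
    and lam: "\<And>x. lam' (mat_act s t a b x) = lam x"
  shows "is_alg_iso R (EH R q lam) (EH R q lam')"
proof -
  let ?L = "eh_lie R q" and ?g = "mat_act s t a b"
  note L = lie_closed_eh_lie[OF q]
  obtain H where H: "H \<in> alg_iso R (univ_env R ?L) (univ_env R ?L)"
    and Hi: "\<And>x. x \<in> carrier ?L \<Longrightarrow> H (ue_incl R ?L x) = ue_incl R ?L (eh_twist s t a b x)"
    using univ_env_alg_iso[OF L L eh_twist_lie_iso[OF det q]] by blast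
  have U: "scalar_alg R (EH_tilde R q)"
    unfolding EH_tilde_def by (rule scalar_alg_univ_env[OF L])
  then interpret U: scalar_alg R "EH_tilde R q" .
  have H: "H \<in> alg_iso R (EH_tilde R q) (EH_tilde R q)" using H by (simp add: EH_tilde_def)
  then have hom: "H \<in> ring_hom (EH_tilde R q) (EH_tilde R q)" by (simp add: alg_iso_def ring_iso_def)
  interpret H: ring_hom_ring "EH_tilde R q" "EH_tilde R q" H
    by (rule ring_hom_ringI2[OF U.ring_axioms U.ring_axioms hom])
  have incl: "ue_incl R ?L x \<in> carrier (EH_tilde R q)" if "x \<in> carrier ?L" for x
    using free_gen_closed[OF that]
    by (auto simp: EH_tilde_def univ_env_def ue_incl_def carrier_Quot)
  let ?r = "\<lambda>lam x. ue_incl R ?L (eh_central R x)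
      \<ominus>\<^bsub>EH_tilde R q\<^esub> [(lam x :: int)] \<cdot>\<^bsub>EH_tilde R q\<^esub> \<one>\<^bsub>EH_tilde R q\<^esub>"
  have cen: "ue_incl R ?L (eh_central R x) \<in> carrier (EH_tilde R q)" for x
    by (rule incl) (simp add: eh_central_closed)
  have Hint: "H ([(k :: int)] \<cdot>\<^bsub>EH_tilde R q\<^esub> \<one>\<^bsub>EH_tilde R q\<^esub>) = [k] \<cdot>\<^bsub>EH_tilde R q\<^esub> \<one>\<^bsub>EH_tilde R q\<^esub>" for k
    using group_hom.hom_int_pow[OF H.a_group_hom, of "\<one>\<^bsub>EH_tilde R q\<^esub>" k]
    by (simp add: add_pow_def)
  have "H (?r lam x) = ?r lam' (?g x)" for x
    using ring_hom_minus[OF U.ring_axioms U.ring_axioms hom, of "ue_incl R ?L (eh_central R x)"]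
    by (simp add: cen Hint Hi eh_central_closed eh_twist_central lam)
  then have "H ` range (?r lam) = range (\<lambda>x. ?r lam' (?g x))"
    by (simp add: image_image)
  also have "\<dots> = ?r lam' ` range ?g" by (simp add: image_image)
  also have "range ?g = UNIV"
    using mat_act_inverse(2)[OF det] by (rule surjI)
  finally have im: "H ` range (?r lam) = range (?r lam')" .
  have "range (?r lam) \<subseteq> carrier (EH_tilde R q)"
    using cen by auto
  from alg_iso_quotient[OF U U H this]
  show ?thesis
    unfolding is_alg_iso_def EH_def EH_ideal_def im by blast
qed

end

section \<open>Normal form of integral linear forms\<close>

text \<open>
  The linear form is \<open>k\<close> times the bottom row of the matrix.
\<close>

lemma int_linear_normal_form:
  assumes "int_linear lam"
  obtains s t a b k where "s * b - t * a = 1" "\<And>x. lam_k k (mat_act s t a b x) = lam x"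
proof -
  define c d where "c = lam (1, 0)" and "d = lam (0, 1)"
  have lam: "lam (r, n) = r * c + n * d" for r n
  proof -
    have "lam (r, n) = lam (r * 1, r * 0) + lam (n * 0, n * 1)"
      using assms unfolding int_linear_def by (metis add_Pair add_0_left add_0_right mult_1_right mult_zero_right)
    then show ?thesis
      using assms by (simp only: int_linear_def c_def d_def)
  qed
  show ?thesis
  proof (cases "gcd c d = 0")
    case True
    then show ?thesis
      by (intro that[where s = 1 and t = 0 and a = 0 and b = 1 and k = 0]) (auto simp: lam lam_k_def mat_act_def)
  next
    case False
    obtain u v where uv: "u * c + v * d = gcd c d"
      using bezout_int by blast
    obtain c' d' where cd: "c = gcd c d * c'" "d = gcd c d * d'"
      by (meson dvdE gcd_dvd1 gcd_dvd2)
    have "gcd c d * (u * c' + v * d') = gcd c d * 1"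
      using uv cd by (metis distrib_left mult.left_commute mult.right_neutral)
    then have "u * c' + v * d' = 1"
      using False by (metis mult_left_cancel)
    \<comment> \<open>The Bezout coefficients, up to sign and order, form the top row above \<open>(c', d')\<close>.\<close>
    then have "v * d' - (- u) * c' = 1"
      by (simp add: algebra_simps)
    moreover have "lam (r, n) = gcd c d * (c' * r + d' * n)" for r n
      unfolding lam using cd by (metis distrib_left mult.assoc mult.commute)
    ultimately show ?thesis
      by (intro that[where s = v and t = "- u" and a = c' and b = d' and k = "gcd c d"])
        (auto simp: lam_k_def mat_act_def)
  qed
qed

theorem proposition2p4:
  fixes R :: "('a, 'm) ring_scheme" and q :: 'a and lam :: "int \<times> int \<Rightarrow> int"
  assumes "domain R"
    and "q \<in> Units R"
    and "\<And>d :: int. d \<noteq> 0 \<Longrightarrow> qdiff R q d \<in> Units R"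
    and "int_linear lam"
  shows "\<exists>k :: int. is_alg_iso R (EH R q lam) (EH_k R q k)"
proof -
  interpret domain R by fact
  have q: "qdiff R q d \<in> carrier R" for d
    using assms(3)[of d] by (cases "d = 0") (auto simp: qdiff_def)
  obtain s t a b k where "s * b - t * a = 1" "\<And>x. lam_k k (mat_act s t a b x) = lam x"
    using int_linear_normal_form[OF assms(4)] by metis
  then have "is_alg_iso R (EH R q lam) (EH_k R q k)"
    unfolding EH_k_def by (rule EH_alg_iso[OF q])
  then show ?thesis ..
qed

end
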